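(* Let $m,n\ge 1$ be integers, let $\mathcal{Y}\subseteq\mathbb{R}^n$, let $h:\mathbb{R}^n\to\mathbb{R}$ and $H^i:\mathbb{R}^n\times\mathbb{R}\to\mathbb{R}$, $i\in[m]$, be functions. For each $i\in[m]$ let $S_i\ge 1$ be an integer, $d^i_1,\dots,d^i_{S_i}\in\mathbb{R}$, $q^i\in\mathrm{ri}(\Delta^{S_i})$, and $\epsilon^i>0$. Consider the KL divergence constrained distributionally robust optimization problem $$\min_{y\in\mathcal{Y}}\Big\{h(y)+\sum_{i=1}^m\ \max_{p^i\in\Delta^{S_i}:\,D_{KL}(p^i\|q^i)\le\epsilon^i}\ \sum_{s=1}^{S_i}p^i_s\,H^i(y,d^i_s)\Big\}$$ and its robust counterpart $$\text{(R)}\qquad\begin{aligned}\min\ \ & h(y)+\sum_{i=1}^m\Big[\alpha^i+\epsilon^i\beta^i+\sum_{s=1}^{S_i}q^i_s u^i_s\Big]\\ \text{s.t. }\ & \alpha^i-v^i_s\ge H^i(y,d^i_s), && i\in[m],\ s\in[S_i],\\ & \beta^i+w^i_s=0, && i\in[m],\ s\in[S_i],\\ & \alpha^i\in\mathbb{R},\ \beta^i\in\mathbb{R}_+, && i\in[m],\\ & (u^i_s,v^i_s,w^i_s)\in(K_{\exp})_*, && i\in[m],\ s\in[S_i],\\ & y\in\mathcal{Y}.\end{aligned}$$ Assume in addition that $\mathcal{Y}$ is a conic representable set (respectively, a mixed-integer conic representable set), that $h$ is a conic representable function, and that for each $i\in[m]$ the function $H^i(y,\xi^i)$ is conic representable as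 a function of $y$ (for every fixed value of $\xi^i$). Then (R) is a dual exponential cone constrained program (respectively, a dual exponential cone constrained mixed-integer program).
   Context: Notation: $[k]=\{1,\dots,k\}$; $\mathrm{ri}$ and $\mathrm{cl}$ denote relative interior and closure. The probability simplex is $\Delta^S=\{p\in\mathbb{R}^S_+:\sum_{s=1}^S p_s=1\}$. For $p\in\Delta^S$ and $q\in\mathrm{ri}(\Delta^S)$, $D_{KL}(p\|q)=\sum_{s=1}^S p_s\log(p_s/q_s)$, with $0\log0=0$. The exponential cone is $K_{\exp}=\mathrm{cl}\{x\in\mathbb{R}^3: x_1\ge x_2e^{x_3/x_2},\ x_2>0\}$ and its dual cone is $(K_{\exp})_*=\{s\in\mathbb{R}^3: x^Ts\ge0\ \ \forall x\in K_{\exp}\}=\mathrm{cl}\{s\in\mathbb{R}^3: s_1\ge -s_3e^{(s_2-s_3)/s_3},\ s_3<0\}$. A cone is regular if it is closed, convex, pointed and full-dimensional; for a regular cone $K$, $x\succeq_K y$ means $x-y\in K$. A set $X\subseteq\mathbb{R}^n$ is conic representable if $X=\{x\in\mathbb{R}^n:\exists z\in\mathbb{R}^k:\ Ax+Bz\succeq_K b\}$ for some matrices $A,B$, vector $b$ and regular cone $K$; it is mixed-integer conic representable if some of the variables ($x$ or $z$) in such a representation are in addition required to be integer. A function is conic representable if its epigraph is a conic representable set. By convention, the cones $K$ allowed in these representations are finite direct products of nonnegative orthants, second-order (Lorentz) cones, cones of positive semidefinite matrices, exponential cones and dual exponential cones. A dual exponential cone constrained (mixed-integer) program is a problem that can be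 written, possibly after introducing auxiliary variables (for instance, epigraph variables), as minimizing a linear function subject to finitely many linear constraints and conic inequalities with respect to cones that are finite direct products of nonnegative orthants, second-order (Lorentz) cones, cones of positive semidefinite matrices, exponential cones and dual exponential cones (including dual exponential cones), with, in the mixed-integer case, some of the variables restricted to be integer. *)

theory Defs
  imports
    "HOL-Analysis.Elementary_Topology"
    "HOL-Analysis.Euclidean_Space"
    "Jordan_Normal_Form.Matrix"
begin

text \<open>Points of \<open>\<real>\<^sup>n\<close> are elements of \<^term>\<open>carrier_vec n :: real vec set\<close>; coordinates are
  numbered from 0.\<close>

section \<open>Probability simplex and relative interior\<close>

definition simplex :: "nat \<Rightarrow> real vec set" where
  "simplex S = {p \<in> carrier_vec S. (\<forall>s<S. 0 \<le> p $ s) \<and> (\<Sum>s<S. p $ s) = 1}"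

definition affine_vec :: "real vec set \<Rightarrow> bool" where
  "affine_vec T \<longleftrightarrow>
     (\<forall>x\<in>T. \<forall>y\<in>T. \<forall>a b. a + b = 1 \<longrightarrow> a \<cdot>\<^sub>v x + b \<cdot>\<^sub>v y \<in> T)"

definition dist_vec :: "real vec \<Rightarrow> real vec \<Rightarrow> real" where
  "dist_vec x y = sqrt ((x - y) \<bullet> (x - y))"

text \<open>Used only for \<open>A \<subseteq> carrier_vec n\<close>; since \<open>carrier_vec n\<close> is affine, the hull then stays in
  \<open>\<real>\<^sup>n\<close>.\<close>

definition rel_interior_vec :: "real vec set \<Rightarrow> real vec set" where
  "rel_interior_vec A =
     {x \<in> A. \<exists>e>0. \<forall>y \<in> affine_vec hull A. dist_vec x y < e \<longrightarrow> y \<in> A}"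

section \<open>Cones\<close>

definition exp_cone :: "(real \<times> real \<times> real) set" where
  "exp_cone = closure {(x1, x2, x3). x1 \<ge> x2 * exp (x3 / x2) \<and> x2 > 0}"

definition dual_exp_cone :: "(real \<times> real \<times> real) set" where
  "dual_exp_cone = {s. \<forall>x\<in>exp_cone. inner x s \<ge> 0}"

text \<open>The symmetric \<open>k \<times> k\<close> matrix with lower triangle \<open>x\<close>, listed row by row. Symmetric matrices
  are thus identified with \<open>\<real>\<^bsup>k(k+1)/2\<^esup>\<close>, in which the positive semidefinite cone has nonempty
  interior.\<close>

definition sym_mat :: "nat \<Rightarrow> real vec \<Rightarrow> real mat" where
  "sym_mat k x =
     mat k k (\<lambda>(i, j). x $ (max i j * (max i j + 1) div 2 + min i j))"

definition psd_mat :: "nat \<Rightarrow> real mat \<Rightarrow> bool" where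
  "psd_mat k M \<longleftrightarrow> (\<forall>v \<in> carrier_vec k. 0 \<le> v \<bullet> (M *\<^sub>v v))"

datatype basic_cone = Orthant nat | Lorentz nat | PSD nat | Exp | DualExp

fun cone_dim :: "basic_cone \<Rightarrow> nat" where
  "cone_dim (Orthant k) = k"
| "cone_dim (Lorentz k) = k + 1"
| "cone_dim (PSD k) = k * (k + 1) div 2"
| "cone_dim Exp = 3"
| "cone_dim DualExp = 3"

fun cone_set :: "basic_cone \<Rightarrow> real vec set" where
  "cone_set (Orthant k) = {x \<in> carrier_vec k. \<forall>j<k. 0 \<le> x $ j}"
| "cone_set (Lorentz k) = {x \<in> carrier_vec (k + 1). sqrt (\<Sum>j<k. (x $ j)\<^sup>2) \<le> x $ k}"
| "cone_set (PSD k) = {x \<in> carrier_vec (k * (k + 1) div 2). psd_mat k (sym_mat k x)}"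
| "cone_set Exp = {vec_of_list [a, b, c] | a b c. (a, b, c) \<in> exp_cone}"
| "cone_set DualExp = {vec_of_list [a, b, c] | a b c. (a, b, c) \<in> dual_exp_cone}"

text \<open>A finite direct product is given by the list of its factors. Every such product is a regular
  cone.\<close>

definition prod_dim :: "basic_cone list \<Rightarrow> nat" where
  "prod_dim Ks = sum_list (map cone_dim Ks)"

fun prod_cone :: "basic_cone list \<Rightarrow> real vec set" where
  "prod_cone [] = carrier_vec 0"
| "prod_cone (K # Ks) = {x @\<^sub>v y | x y. x \<in> cone_set K \<and> y \<in> prod_cone Ks}"

definition cone_ge :: "real vec set \<Rightarrow> real vec \<Rightarrow> real vec \<Rightarrow> bool" where
  "cone_ge K x y \<longleftrightarrow> x - y \<in> K"

section \<open>Conic representability\<close>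

definition conic_representable :: "nat \<Rightarrow> real vec set \<Rightarrow> bool" where
  "conic_representable n X \<longleftrightarrow>
     (\<exists>k Ks A B b.
        A \<in> carrier_mat (prod_dim Ks) n \<and> B \<in> carrier_mat (prod_dim Ks) k \<and>
        b \<in> carrier_vec (prod_dim Ks) \<and>
        X = {x \<in> carrier_vec n. \<exists>z \<in> carrier_vec k.
               cone_ge (prod_cone Ks) (A *\<^sub>v x + B *\<^sub>v z) b})"

definition mi_conic_representable :: "nat \<Rightarrow> real vec set \<Rightarrow> bool" where
  "mi_conic_representable n X \<longleftrightarrow>
     (\<exists>k Ks A B b I J.
        A \<in> carrier_mat (prod_dim Ks) n \<and> B \<in> carrier_mat (prod_dim Ks) k \<and>
        b \<in> carrier_vec (prod_dim Ks) \<and> I \<subseteq> {..<n} \<and> J \<subseteq> {..<k} \<and>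
        X = {x \<in> carrier_vec n. (\<forall>i\<in>I. x $ i \<in> \<int>) \<and>
               (\<exists>z \<in> carrier_vec k. (\<forall>j\<in>J. z $ j \<in> \<int>) \<and>
                  cone_ge (prod_cone Ks) (A *\<^sub>v x + B *\<^sub>v z) b)})"

definition epigraph_vec :: "nat \<Rightarrow> (real vec \<Rightarrow> real) \<Rightarrow> real vec set" where
  "epigraph_vec n f = {x @\<^sub>v vec_of_list [t] | x t. x \<in> carrier_vec n \<and> f x \<le> t}"

definition conic_representable_fun :: "nat \<Rightarrow> (real vec \<Rightarrow> real) \<Rightarrow> bool" where
  "conic_representable_fun n f \<longleftrightarrow> conic_representable (n + 1) (epigraph_vec n f)"

section \<open>Dual exponential cone constrained programs\<close>

record conic_program =
  num_vars :: nat
  cost :: "real vec"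
  eq_mat :: "real mat"
  eq_rhs :: "real vec"
  ineq_mat :: "real mat"
  ineq_rhs :: "real vec"
  cones :: "basic_cone list"
  cone_mat :: "real mat"
  cone_rhs :: "real vec"
  int_vars :: "nat set"

definition wf_program :: "conic_program \<Rightarrow> bool" where
  "wf_program P \<longleftrightarrow>
     cost P \<in> carrier_vec (num_vars P) \<and>
     eq_mat P \<in> carrier_mat (dim_vec (eq_rhs P)) (num_vars P) \<and>
     ineq_mat P \<in> carrier_mat (dim_vec (ineq_rhs P)) (num_vars P) \<and>
     cone_mat P \<in> carrier_mat (prod_dim (cones P)) (num_vars P) \<and>
     cone_rhs P \<in> carrier_vec (prod_dim (cones P)) \<and>
     int_vars P \<subseteq> {..<num_vars P}"

definition program_feasible :: "conic_program \<Rightarrow> real vec set" where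
  "program_feasible P =
     {x \<in> carrier_vec (num_vars P).
        eq_mat P *\<^sub>v x = eq_rhs P \<and>
        (\<forall>r < dim_vec (ineq_rhs P). (ineq_mat P *\<^sub>v x) $ r \<ge> ineq_rhs P $ r) \<and>
        cone_ge (prod_cone (cones P)) (cone_mat P *\<^sub>v x) (cone_rhs P) \<and>
        (\<forall>i \<in> int_vars P. x $ i \<in> \<int>)}"

definition program_objective :: "conic_program \<Rightarrow> real vec \<Rightarrow> real" where
  "program_objective P x = cost P \<bullet> x"

text \<open>The problem of minimizing \<open>f\<close> over \<open>F \<subseteq> \<real>\<^sup>N\<close> is written as \<open>P\<close>, whose first \<open>N\<close> variables are
  the original ones and whose remaining variables are auxiliary: projecting away the auxiliary
  variables turns the feasible set of \<open>P\<close> into \<open>F\<close>, and for fixed original variables \<open>x \<in> F\<close> the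
  least objective value of \<open>P\<close> is attained and equals \<open>f x\<close>.\<close>

definition written_as ::
    "nat \<Rightarrow> real vec set \<Rightarrow> (real vec \<Rightarrow> real) \<Rightarrow> conic_program \<Rightarrow> bool" where
  "written_as N F f P \<longleftrightarrow>
     N \<le> num_vars P \<and>
     (\<forall>\<xi> \<in> program_feasible P.
        vec_first \<xi> N \<in> F \<and> f (vec_first \<xi> N) \<le> program_objective P \<xi>) \<and>
     (\<forall>x \<in> F. \<exists>\<xi> \<in> program_feasible P. vec_first \<xi> N = x \<and> program_objective P \<xi> = f x)"

definition dual_exp_mi_program :: "nat \<Rightarrow> real vec set \<Rightarrow> (real vec \<Rightarrow> real) \<Rightarrow> bool" where
  "dual_exp_mi_program N F f \<longleftrightarrow>
     (\<exists>P. wf_program P \<and> DualExp \<in> set (cones P) \<and> written_as N F f P)"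

definition dual_exp_program :: "nat \<Rightarrow> real vec set \<Rightarrow> (real vec \<Rightarrow> real) \<Rightarrow> bool" where
  "dual_exp_program N F f \<longleftrightarrow>
     (\<exists>P. wf_program P \<and> DualExp \<in> set (cones P) \<and> int_vars P = {} \<and> written_as N F f P)"

section \<open>The robust counterpart\<close>

text \<open>The decision vector is the concatenation of \<open>y\<close>, \<open>\<alpha>\<close>, \<open>\<beta>\<close>, \<open>u\<close>, \<open>v\<close>, \<open>w\<close>, where the doubly
  indexed families \<open>u\<close>, \<open>v\<close>, \<open>w\<close> are listed with \<open>i\<close> as the slow index.\<close>

definition offset :: "(nat \<Rightarrow> nat) \<Rightarrow> nat \<Rightarrow> nat" where
  "offset S i = (\<Sum>j<i. S j)"

definition rc_dim :: "nat \<Rightarrow> nat \<Rightarrow> (nat \<Rightarrow> nat) \<Rightarrow> nat" where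
  "rc_dim n m S = n + 2 * m + 3 * offset S m"

definition y_of :: "nat \<Rightarrow> real vec \<Rightarrow> real vec" where
  "y_of n x = vec_first x n"

definition alpha_of :: "nat \<Rightarrow> real vec \<Rightarrow> nat \<Rightarrow> real" where
  "alpha_of n x i = x $ (n + i)"

definition beta_of :: "nat \<Rightarrow> nat \<Rightarrow> real vec \<Rightarrow> nat \<Rightarrow> real" where
  "beta_of n m x i = x $ (n + m + i)"

definition u_of :: "nat \<Rightarrow> nat \<Rightarrow> (nat \<Rightarrow> nat) \<Rightarrow> real vec \<Rightarrow> nat \<Rightarrow> nat \<Rightarrow> real" where
  "u_of n m S x i s = x $ (n + 2 * m + offset S i + s)"

definition v_of :: "nat \<Rightarrow> nat \<Rightarrow> (nat \<Rightarrow> nat) \<Rightarrow> real vec \<Rightarrow> nat \<Rightarrow> nat \<Rightarrow> real" where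
  "v_of n m S x i s = x $ (n + 2 * m + offset S m + offset S i + s)"

definition w_of :: "nat \<Rightarrow> nat \<Rightarrow> (nat \<Rightarrow> nat) \<Rightarrow> real vec \<Rightarrow> nat \<Rightarrow> nat \<Rightarrow> real" where
  "w_of n m S x i s = x $ (n + 2 * m + 2 * offset S m + offset S i + s)"

definition rc_feasible ::
    "nat \<Rightarrow> nat \<Rightarrow> real vec set \<Rightarrow> (nat \<Rightarrow> real vec \<Rightarrow> real \<Rightarrow> real) \<Rightarrow> (nat \<Rightarrow> nat) \<Rightarrow>
     (nat \<Rightarrow> nat \<Rightarrow> real) \<Rightarrow> real vec set" where
  "rc_feasible n m Y H S d =
     {x \<in> carrier_vec (rc_dim n m S).
        (\<forall>i<m. \<forall>s<S i. alpha_of n x i - v_of n m S x i s \<ge> H i (y_of n x) (d i s)) \<and>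
        (\<forall>i<m. \<forall>s<S i. beta_of n m x i + w_of n m S x i s = 0) \<and>
        (\<forall>i<m. beta_of n m x i \<ge> 0) \<and>
        (\<forall>i<m. \<forall>s<S i.
           (u_of n m S x i s, v_of n m S x i s, w_of n m S x i s) \<in> dual_exp_cone) \<and>
        y_of n x \<in> Y}"

definition rc_objective ::
    "nat \<Rightarrow> nat \<Rightarrow> (real vec \<Rightarrow> real) \<Rightarrow> (nat \<Rightarrow> nat) \<Rightarrow> (nat \<Rightarrow> real vec) \<Rightarrow>
     (nat \<Rightarrow> real) \<Rightarrow> real vec \<Rightarrow> real" where
  "rc_objective n m h S q \<epsilon> x =
     h (y_of n x) +
     (\<Sum>i<m. alpha_of n x i + \<epsilon> i * beta_of n m x i +
        (\<Sum>s<S i. q i $ s * u_of n m S x i s))"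

end

theory Submission
  imports Defs
begin

text \<open>Projections of (mixed-integer) affine slices of product cones are closed under finite
  intersections and linear preimages, so every constraint of (R) and the epigraph constraint
  \<open>h y \<le> t\<close> can be collected into a single such set. Replacing \<open>h y\<close> by the epigraph variable \<open>t\<close>
  makes the objective linear, because all its remaining terms are linear already.\<close>

text \<open>The obstacle is bookkeeping: the data arrive as matrices over different lists of
  variables. Rows are therefore handled as homogeneous linear functionals, with the constants kept
  apart, so that selecting, reindexing and padding variables are all substitutions;
  \<open>conic_sliceI\<close> turns functionals back into a matrix. Their values are prescribed on
  \<open>carrier_vec N\<close> only, since entries beyond the dimension of a vector carry no
  meaning. Linear equations and inequalities become orthant constraints, so one product cone holds
  everything. The attainment that \<open>written_as\<close> demands comes from \<open>h\<close>
  being real-valued: t = h y is always an admissible choice.\<close>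

section \<open>Linear functionals in coordinates\<close>

definition linear_functional :: "nat \<Rightarrow> (real vec \<Rightarrow> real) \<Rightarrow> bool" where
  "linear_functional N g \<longleftrightarrow> (\<exists>a. \<forall>x\<in>carrier_vec N. g x = (\<Sum>i<N. a i * x $ i))"

lemma linear_functional_cong:
  assumes "linear_functional N f" and "\<And>x. x \<in> carrier_vec N \<Longrightarrow> f x = g x"
  shows "linear_functional N g"
  using assms unfolding linear_functional_def by metis

lemma linear_functional_index:
  assumes "j < N"
  shows "linear_functional N (\<lambda>x. x $ j)"
proof -
  have "x $ j = (\<Sum>i<N. (if i = j then 1 else 0) * x $ i)" for x :: "real vec"
    using assms by (simp add: if_distrib[of "\<lambda>c. c * _"] sum.delta cong: if_cong)
  then show ?thesis
    unfolding linear_functional_def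
    by (intro exI[of _ "\<lambda>i. if i = j then 1 else 0"] ballI)
qed

lemma linear_functional_zero: "linear_functional N (\<lambda>x. 0)"
  unfolding linear_functional_def by (intro exI[of _ "\<lambda>i. 0"]) simp

lemma linear_functional_add:
  assumes "linear_functional N f" and "linear_functional N g"
  shows "linear_functional N (\<lambda>x. f x + g x)"
proof -
  obtain a b where "\<forall>x\<in>carrier_vec N. f x = (\<Sum>i<N. a i * x $ i)"
    and "\<forall>x\<in>carrier_vec N. g x = (\<Sum>i<N. b i * x $ i)"
    using assms unfolding linear_functional_def by blast
  then show ?thesis
    unfolding linear_functional_def
    by (intro exI[of _ "\<lambda>i. a i + b i"]) (simp add: distrib_right sum.distrib)
qed

lemma linear_functional_scale:
  assumes "linear_functional N f"
  shows "linear_functional N (\<lambda>x. c * f x)"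
proof -
  obtain a where "\<forall>x\<in>carrier_vec N. f x = (\<Sum>i<N. a i * x $ i)"
    using assms unfolding linear_functional_def by blast
  then show ?thesis
    unfolding linear_functional_def
    by (intro exI[of _ "\<lambda>i. c * a i"]) (simp add: sum_distrib_left mult.assoc)
qed

lemma linear_functional_diff:
  assumes "linear_functional N f" and "linear_functional N g"
  shows "linear_functional N (\<lambda>x. f x - g x)"
  using linear_functional_add[OF assms(1) linear_functional_scale[OF assms(2), of "-1"]] by simp

lemma linear_functional_sum:
  assumes "\<And>i. i < (k::nat) \<Longrightarrow> linear_functional N (f i)"
  shows "linear_functional N (\<lambda>x. \<Sum>i<k. f i x)"
  using assms by (induction k) (auto intro: linear_functional_zero linear_functional_add)

lemma linear_functional_compose:
  assumes "linear_functional N g" and "\<And>i. i < N \<Longrightarrow> linear_functional M (f i)"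
  shows "linear_functional M (\<lambda>x. g (vec N (\<lambda>i. f i x)))"
proof -
  obtain a where a: "\<forall>x\<in>carrier_vec N. g x = (\<Sum>i<N. a i * x $ i)"
    using assms(1) unfolding linear_functional_def by blast
  have "linear_functional M (\<lambda>x. \<Sum>i<N. a i * f i x)"
    by (intro linear_functional_sum linear_functional_scale assms(2))
  then show ?thesis
    by (rule linear_functional_cong) (simp add: a)
qed

lemma linear_functional_mult_mat_vec:
  assumes "A \<in> carrier_mat k N" and "i < k"
  shows "linear_functional N (\<lambda>x. (A *\<^sub>v x) $ i)"
proof -
  have "(A *\<^sub>v x) $ i = (\<Sum>j<N. A $$ (i, j) * x $ j)" if "x \<in> carrier_vec N" for x
    using assms that by (simp add: scalar_prod_def atLeast0LessThan)
  then show ?thesis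
    unfolding linear_functional_def by (intro exI[of _ "\<lambda>j. A $$ (i, j)"]) simp
qed

lemmas linear_functional_intros =
  linear_functional_zero linear_functional_add linear_functional_diff
  linear_functional_scale linear_functional_sum linear_functional_index

section \<open>Product cones and concatenation\<close>

lemma cone_set_carrier: "cone_set K \<subseteq> carrier_vec (cone_dim K)"
proof
  fix x assume x: "x \<in> cone_set K"
  show "x \<in> carrier_vec (cone_dim K)"
  proof (cases K)
    case Exp
    with x have "\<exists>a b c. x = vec_of_list [a, b, c]" by (simp del: vec_of_list_Cons) blast
    with Exp show ?thesis by (auto intro: carrier_vecI)
  next
    case DualExp
    with x have "\<exists>a b c. x = vec_of_list [a, b, c]" by (simp del: vec_of_list_Cons) blast
    with DualExp show ?thesis by (auto intro: carrier_vecI)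
  qed (use x in simp_all)
qed

lemma prod_cone_carrier: "prod_cone Ks \<subseteq> carrier_vec (prod_dim Ks)"
proof (induction Ks)
  case (Cons K Ks)
  then show ?case
    using cone_set_carrier[of K] by (auto simp: prod_dim_def)
qed (simp add: prod_dim_def)

lemma prod_dim_append: "prod_dim (Ks @ Ls) = prod_dim Ks + prod_dim Ls"
  by (simp add: prod_dim_def)

lemma append_vec_assoc: "(x @\<^sub>v y) @\<^sub>v z = x @\<^sub>v (y @\<^sub>v z)"
  by (intro eq_vecI) auto

lemma append_vec_Nil: "x \<in> carrier_vec 0 \<Longrightarrow> x @\<^sub>v y = y" "x \<in> carrier_vec 0 \<Longrightarrow> y @\<^sub>v x = y"
  by (auto intro!: eq_vecI)

lemma prod_cone_append:
  "prod_cone (Ks @ Ls) = {x @\<^sub>v y | x y. x \<in> prod_cone Ks \<and> y \<in> prod_cone Ls}"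
proof (induction Ks)
  case Nil
  have "(\<exists>x y. v = x @\<^sub>v y \<and> x \<in> carrier_vec 0 \<and> y \<in> prod_cone Ls) \<longleftrightarrow> v \<in> prod_cone Ls" for v
    using append_vec_Nil(1)[OF zero_carrier_vec] append_vec_Nil(1) zero_carrier_vec by metis
  then show ?case by simp
next
  case (Cons K Ks)
  have "(\<exists>x y. v = x @\<^sub>v y \<and> x \<in> cone_set K \<and>
        (\<exists>x' y'. y = x' @\<^sub>v y' \<and> x' \<in> prod_cone Ks \<and> y' \<in> prod_cone Ls)) \<longleftrightarrow>
      (\<exists>x y. v = x @\<^sub>v y \<and> (\<exists>x' y'. x = x' @\<^sub>v y' \<and> x' \<in> cone_set K \<and> y' \<in> prod_cone Ks) \<and>
        y \<in> prod_cone Ls)" (is "?L \<longleftrightarrow> ?R") for v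
  proof
    assume ?L
    then obtain x x' y' where "v = x @\<^sub>v (x' @\<^sub>v y')" "x \<in> cone_set K" "x' \<in> prod_cone Ks"
      "y' \<in> prod_cone Ls" by blast
    then show ?R by (intro exI[of _ "x @\<^sub>v x'"] exI[of _ y']) (auto simp: append_vec_assoc)
  next
    assume ?R
    then obtain x x' y' where "v = (x @\<^sub>v x') @\<^sub>v y'" "x \<in> cone_set K" "x' \<in> prod_cone Ks"
      "y' \<in> prod_cone Ls" by blast
    then show ?L by (intro exI[of _ x] exI[of _ "x' @\<^sub>v y'"]) (auto simp: append_vec_assoc)
  qed
  then show ?case
    unfolding append_Cons prod_cone.simps Cons mem_Collect_eq by presburger
qed

text \<open>All members of \<open>prod_cone Ks\<close> have length \<open>prod_dim Ks\<close>.
  Fixing the length of \<open>x\<close> thus makes the split unique, and no other decomposition of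
  the concatenation can witness membership.\<close>

lemma append_in_prod_cone:
  assumes "x \<in> carrier_vec (prod_dim Ks)"
  shows "x @\<^sub>v y \<in> prod_cone (Ks @ Ls) \<longleftrightarrow> x \<in> prod_cone Ks \<and> y \<in> prod_cone Ls"
proof -
  have eq: "x @\<^sub>v y = x' @\<^sub>v y' \<longleftrightarrow> x = x' \<and> y = y'" if "x' \<in> prod_cone Ks" for x' y'
    using append_vec_eq[OF assms] that prod_cone_carrier by blast
  show ?thesis
  proof
    assume "x @\<^sub>v y \<in> prod_cone (Ks @ Ls)"
    then obtain x' y' where "x @\<^sub>v y = x' @\<^sub>v y'" "x' \<in> prod_cone Ks" "y' \<in> prod_cone Ls"
      unfolding prod_cone_append mem_Collect_eq by (elim exE conjE)
    then show "x \<in> prod_cone Ks \<and> y \<in> prod_cone Ls"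
      using eq by simp
  next
    assume "x \<in> prod_cone Ks \<and> y \<in> prod_cone Ls"
    then show "x @\<^sub>v y \<in> prod_cone (Ks @ Ls)"
      unfolding prod_cone_append by blast
  qed
qed

lemma prod_cone_single: "prod_cone [K] = cone_set K"
proof -
  have "(\<exists>x y. v = x @\<^sub>v y \<and> x \<in> cone_set K \<and> y \<in> carrier_vec 0) \<longleftrightarrow> v \<in> cone_set K" for v
    using append_vec_Nil(2)[OF zero_carrier_vec] append_vec_Nil(2) zero_carrier_vec by metis
  then show ?thesis by simp
qed

section \<open>Affine slices of product cones\<close>

text \<open>Without auxiliary variables, intersections and preimages need no projection. The cone
  list is a parameter so that the cones of an intersection are known; this is how
  \<open>DualExp\<close> is later seen to occur in the program.\<close>

definition conic_slice :: "basic_cone list \<Rightarrow> nat \<Rightarrow> real vec set \<Rightarrow> bool" where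
  "conic_slice Ks N X \<longleftrightarrow>
     (\<exists>A \<in> carrier_mat (prod_dim Ks) N. \<exists>b \<in> carrier_vec (prod_dim Ks).
        X = {x \<in> carrier_vec N. cone_ge (prod_cone Ks) (A *\<^sub>v x) b})"

text \<open>Together with \<open>conic_sliceD\<close> this passes between the matrix form and rows
  given as functionals. The constants \<open>b\<close> stay outside \<open>g\<close> because a
  linear substitution leaves them unchanged.\<close>

lemma conic_sliceI:
  assumes "\<And>i. i < prod_dim Ks \<Longrightarrow> linear_functional N (g i)"
    and "X = {x \<in> carrier_vec N. vec (prod_dim Ks) (\<lambda>i. g i x - b i) \<in> prod_cone Ks}"
  shows "conic_slice Ks N X"
proof -
  obtain a where a: "\<And>i x. i < prod_dim Ks \<Longrightarrow> x \<in> carrier_vec N \<Longrightarrow>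
      g i x = (\<Sum>j<N. a i j * x $ j)"
    using assms(1) unfolding linear_functional_def by metis
  let ?A = "mat (prod_dim Ks) N (\<lambda>(i, j). a i j)"
  have "?A *\<^sub>v x - vec (prod_dim Ks) b = vec (prod_dim Ks) (\<lambda>i. g i x - b i)"
    if "x \<in> carrier_vec N" for x
    using that by (intro eq_vecI) (auto simp: a scalar_prod_def atLeast0LessThan)
  then have "X = {x \<in> carrier_vec N.
      cone_ge (prod_cone Ks) (?A *\<^sub>v x) (vec (prod_dim Ks) b)}"
    unfolding assms(2) cone_ge_def by auto
  then show ?thesis
    unfolding conic_slice_def by (metis mat_carrier vec_carrier)
qed

lemma conic_sliceD:
  assumes "conic_slice Ks N X"
  shows "\<exists>g b. (\<forall>i < prod_dim Ks. linear_functional N (g i)) \<and>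
    X = {x \<in> carrier_vec N. vec (prod_dim Ks) (\<lambda>i. g i x - b i) \<in> prod_cone Ks}"
proof -
  obtain A b where A: "A \<in> carrier_mat (prod_dim Ks) N" and b: "b \<in> carrier_vec (prod_dim Ks)"
    and X: "X = {x \<in> carrier_vec N. cone_ge (prod_cone Ks) (A *\<^sub>v x) b}"
    using assms unfolding conic_slice_def by blast
  have "vec (prod_dim Ks) (\<lambda>i. (A *\<^sub>v x) $ i - b $ i) = A *\<^sub>v x - b" for x
    using A b by (intro eq_vecI) auto
  then show ?thesis
    unfolding X cone_ge_def
    by (intro exI[of _ "\<lambda>i x. (A *\<^sub>v x) $ i"] exI[of _ "\<lambda>i. b $ i"])
      (simp add: linear_functional_mult_mat_vec[OF A])
qed

lemma conic_slice_subset: "conic_slice Ks N X \<Longrightarrow> X \<subseteq> carrier_vec N"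
  unfolding conic_slice_def by blast

text \<open>The two systems are stacked: rows below \<open>prod_dim Ks\<close> come from
  \<open>X\<close>, the others from \<open>Y\<close>, and \<open>append_in_prod_cone\<close>
  separates the two memberships again.\<close>

lemma conic_slice_Int:
  assumes "conic_slice Ks N X" and "conic_slice Ls N Y"
  shows "conic_slice (Ks @ Ls) N (X \<inter> Y)"
proof -
  let ?k = "prod_dim Ks" and ?l = "prod_dim Ls"
  obtain f b where f: "\<forall>i < ?k. linear_functional N (f i)"
    and X: "X = {x \<in> carrier_vec N. vec ?k (\<lambda>i. f i x - b i) \<in> prod_cone Ks}"
    using conic_sliceD[OF assms(1)] by blast
  obtain g c where g: "\<forall>i < ?l. linear_functional N (g i)"
    and Y: "Y = {x \<in> carrier_vec N. vec ?l (\<lambda>i. g i x - c i) \<in> prod_cone Ls}"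
    using conic_sliceD[OF assms(2)] by blast
  let ?h = "\<lambda>i. if i < ?k then f i else g (i - ?k)"
  let ?e = "\<lambda>i. if i < ?k then b i else c (i - ?k)"
  have h: "vec (prod_dim (Ks @ Ls)) (\<lambda>i. ?h i x - ?e i) =
      vec ?k (\<lambda>i. f i x - b i) @\<^sub>v vec ?l (\<lambda>i. g i x - c i)" for x
    by (intro eq_vecI) (auto simp: prod_dim_append)
  show ?thesis
  proof (rule conic_sliceI)
    show "linear_functional N (?h i)" if "i < prod_dim (Ks @ Ls)" for i
      using that f g by (auto simp: prod_dim_append)
    show "X \<inter> Y = {x \<in> carrier_vec N.
        vec (prod_dim (Ks @ Ls)) (\<lambda>i. ?h i x - ?e i) \<in> prod_cone (Ks @ Ls)}"
      unfolding X Y h by (subst append_in_prod_cone) auto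
  qed
qed

text \<open>Only the rows change, by substitution; the cones and the constants stay.\<close>

lemma conic_slice_preimage:
  assumes "conic_slice Ks N X" and "\<And>i. i < N \<Longrightarrow> linear_functional M (f i)"
  shows "conic_slice Ks M {x \<in> carrier_vec M. vec N (\<lambda>i. f i x) \<in> X}"
proof -
  obtain g b where g: "\<forall>i < prod_dim Ks. linear_functional N (g i)"
    and X: "X = {x \<in> carrier_vec N. vec (prod_dim Ks) (\<lambda>i. g i x - b i) \<in> prod_cone Ks}"
    using conic_sliceD[OF assms(1)] by blast
  show ?thesis
  proof (rule conic_sliceI)
    show "linear_functional M (\<lambda>x. g i (vec N (\<lambda>i. f i x)))" if "i < prod_dim Ks" for i
      using g[rule_format, OF that] assms(2) by (rule linear_functional_compose)
  qed (simp add: X)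
qed

lemma conic_slice_cone_set:
  assumes "\<And>i. i < cone_dim K \<Longrightarrow> linear_functional M (f i)"
  shows "conic_slice [K] M {x \<in> carrier_vec M. vec (cone_dim K) (\<lambda>i. f i x) \<in> cone_set K}"
proof -
  have "prod_dim [K] = cone_dim K" by (simp add: prod_dim_def)
  with assms show ?thesis
    by (intro conic_sliceI[where g = f and b = "\<lambda>i. 0"]) (simp_all only: prod_cone_single diff_0_right)
qed

section \<open>Projections of slices, with optional integrality\<close>

text \<open>Integrality is imposed on auxiliary variables only, since this survives linear preimages; an
  integer variable among the original ones is tied to an integer auxiliary copy. The flag \<open>mi\<close> tells
  whether integer variables are allowed.\<close>

definition proj_conic :: "bool \<Rightarrow> nat \<Rightarrow> real vec set \<Rightarrow> bool" where
  "proj_conic mi N X \<longleftrightarrow>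
     (\<exists>k Ks X' J. conic_slice Ks (N + k) X' \<and> J \<subseteq> {..<k} \<and> (J \<noteq> {} \<longrightarrow> mi) \<and>
        X = {x \<in> carrier_vec N. \<exists>z \<in> carrier_vec k. (\<forall>j\<in>J. z $ j \<in> \<int>) \<and> x @\<^sub>v z \<in> X'})"

lemma proj_conic_slice:
  assumes "conic_slice Ks N X"
  shows "proj_conic mi N X"
proof -
  have "X = {x \<in> carrier_vec N. \<exists>z \<in> carrier_vec 0. (\<forall>j\<in>{}. z $ j \<in> \<int>) \<and> x @\<^sub>v z \<in> X}"
  proof -
    have "(\<exists>z \<in> carrier_vec 0. x @\<^sub>v z \<in> X) \<longleftrightarrow> x \<in> X" for x
      using append_vec_Nil(2)[OF zero_carrier_vec] append_vec_Nil(2) zero_carrier_vec by metis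
    then show ?thesis
      using conic_slice_subset[OF assms] by auto
  qed
  then show ?thesis
    using assms unfolding proj_conic_def
    by (intro exI[of _ 0] exI[of _ Ks] exI[of _ X] exI[of _ "{}"]) simp
qed

lemma proj_conic_subset: "proj_conic mi N X \<Longrightarrow> X \<subseteq> carrier_vec N"
  unfolding proj_conic_def by blast

text \<open>The witnesses for the two sets are unrelated, so each set keeps its own auxiliary block.
  Over the vector \<open>x\<close>, \<open>z\<close>, \<open>w\<close> each slice is pulled back
  along the coordinate map that ignores the block of the other.\<close>

lemma proj_conic_Int:
  assumes "proj_conic mi N X" and "proj_conic mi N Y"
  shows "proj_conic mi N (X \<inter> Y)"
proof -
  obtain k Ks X' J where sX: "conic_slice Ks (N + k) X'" and J: "J \<subseteq> {..<k}" "J \<noteq> {} \<longrightarrow> mi"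
    and X: "X = {x \<in> carrier_vec N. \<exists>z \<in> carrier_vec k. (\<forall>j\<in>J. z $ j \<in> \<int>) \<and> x @\<^sub>v z \<in> X'}"
    using assms(1) unfolding proj_conic_def by blast
  obtain l Ls Y' I where sY: "conic_slice Ls (N + l) Y'" and I: "I \<subseteq> {..<l}" "I \<noteq> {} \<longrightarrow> mi"
    and Y: "Y = {x \<in> carrier_vec N. \<exists>z \<in> carrier_vec l. (\<forall>j\<in>I. z $ j \<in> \<int>) \<and> x @\<^sub>v z \<in> Y'}"
    using assms(2) unfolding proj_conic_def by blast
  let ?M = "N + (k + l)"
  let ?X = "{\<xi> \<in> carrier_vec ?M. vec (N + k) (\<lambda>i. \<xi> $ i) \<in> X'}"
  \<comment> \<open>From \<open>N\<close> on, the index shift by \<open>k\<close> skips the block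
    \<open>z\<close> and lands in \<open>w\<close>.\<close>
  let ?Y = "{\<xi> \<in> carrier_vec ?M. vec (N + l) (\<lambda>i. \<xi> $ (if i < N then i else k + i)) \<in> Y'}"
  let ?J = "J \<union> (+) k ` I"
  have slice: "conic_slice (Ks @ Ls) ?M (?X \<inter> ?Y)"
    by (intro conic_slice_Int conic_slice_preimage sX sY linear_functional_index) auto
  have split: "x @\<^sub>v (z @\<^sub>v w) \<in> ?X \<inter> ?Y \<longleftrightarrow> x @\<^sub>v z \<in> X' \<and> x @\<^sub>v w \<in> Y'"
    if "x \<in> carrier_vec N" "z \<in> carrier_vec k" "w \<in> carrier_vec l" for x z w
  proof -
    have "vec (N + k) (\<lambda>i. (x @\<^sub>v (z @\<^sub>v w)) $ i) = x @\<^sub>v z"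
      using that by (intro eq_vecI) auto
    moreover have "vec (N + l) (\<lambda>i. (x @\<^sub>v (z @\<^sub>v w)) $ (if i < N then i else k + i)) = x @\<^sub>v w"
      using that by (intro eq_vecI) auto
    moreover have "x @\<^sub>v (z @\<^sub>v w) \<in> carrier_vec ?M"
      using that by (intro append_carrier_vec)
    ultimately show ?thesis by simp
  qed
  have ints: "(\<forall>j\<in>?J. (z @\<^sub>v w) $ j \<in> \<int>) \<longleftrightarrow> (\<forall>j\<in>J. z $ j \<in> \<int>) \<and> (\<forall>j\<in>I. w $ j \<in> \<int>)"
    if "z \<in> carrier_vec k" "w \<in> carrier_vec l" for z w :: "real vec"
  proof -
    have "(z @\<^sub>v w) $ j = z $ j" if "j \<in> J" for j
      using that J(1) \<open>z \<in> _\<close> by (subst index_append_vec) auto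
    moreover have "(z @\<^sub>v w) $ (k + j) = w $ j" if "j \<in> I" for j
      using that I(1) \<open>z \<in> _\<close> \<open>w \<in> _\<close> by (subst index_append_vec) auto
    ultimately show ?thesis by (simp add: ball_Un)
  qed
  have "X \<inter> Y = {x \<in> carrier_vec N. \<exists>\<zeta> \<in> carrier_vec (k + l).
      (\<forall>j\<in>?J. \<zeta> $ j \<in> \<int>) \<and> x @\<^sub>v \<zeta> \<in> ?X \<inter> ?Y}" (is "_ = ?R")
  proof (intro equalityI subsetI)
    fix x assume "x \<in> X \<inter> Y"
    then obtain z w where x: "x \<in> carrier_vec N" and z: "z \<in> carrier_vec k" "w \<in> carrier_vec l"
      and "\<forall>j\<in>J. z $ j \<in> \<int>" "x @\<^sub>v z \<in> X'" "\<forall>j\<in>I. w $ j \<in> \<int>" "x @\<^sub>v w \<in> Y'"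
      unfolding X Y by blast
    then have "(\<forall>j\<in>?J. (z @\<^sub>v w) $ j \<in> \<int>) \<and> x @\<^sub>v (z @\<^sub>v w) \<in> ?X \<inter> ?Y"
      using split[OF x z] ints[OF z] by blast
    then show "x \<in> ?R"
      using x append_carrier_vec[OF z] by blast
  next
    fix x assume "x \<in> ?R"
    then obtain \<zeta> where x: "x \<in> carrier_vec N" and \<zeta>: "\<zeta> \<in> carrier_vec (k + l)"
      and P: "\<forall>j\<in>?J. \<zeta> $ j \<in> \<int>" "x @\<^sub>v \<zeta> \<in> ?X \<inter> ?Y" by blast
    define z w where "z = vec_first \<zeta> k" and "w = vec_last \<zeta> l"
    have z: "z \<in> carrier_vec k" "w \<in> carrier_vec l" and e: "\<zeta> = z @\<^sub>v w"
      unfolding z_def w_def using vec_first_last_append[OF \<zeta>] by simp_all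
    show "x \<in> X \<inter> Y"
      using P x z unfolding e split[OF x z] ints[OF z] X Y by blast
  qed
  moreover have "?J \<subseteq> {..<k + l}" using J I by auto
  moreover have "?J \<noteq> {} \<longrightarrow> mi" using J I by auto
  ultimately show ?thesis
    using slice unfolding proj_conic_def by blast
qed

text \<open>The linear map is extended by the identity on the auxiliary block, so the same
  \<open>z\<close> and the same \<open>J\<close> serve on both sides.\<close>

lemma proj_conic_preimage:
  assumes "proj_conic mi N X" and "\<And>i. i < N \<Longrightarrow> linear_functional M (f i)"
  shows "proj_conic mi M {x \<in> carrier_vec M. vec N (\<lambda>i. f i x) \<in> X}"
proof -
  obtain k Ks X' J where s: "conic_slice Ks (N + k) X'" and J: "J \<subseteq> {..<k}" "J \<noteq> {} \<longrightarrow> mi"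
    and X: "X = {x \<in> carrier_vec N. \<exists>z \<in> carrier_vec k. (\<forall>j\<in>J. z $ j \<in> \<int>) \<and> x @\<^sub>v z \<in> X'}"
    using assms(1) unfolding proj_conic_def by blast
  \<comment> \<open>The truncation to \<open>M\<close> entries is there because \<open>f i\<close>
    is known to be linear on \<open>carrier_vec M\<close> only. In the target the auxiliary block
    starts at \<open>N\<close>, in the source at \<open>M\<close>.\<close>
  let ?f = "\<lambda>i \<xi>. if i < N then f i (vec M (\<lambda>j. \<xi> $ j)) else \<xi> $ (M + (i - N))"
  let ?X = "{\<xi> \<in> carrier_vec (M + k). vec (N + k) (\<lambda>i. ?f i \<xi>) \<in> X'}"
  have slice: "conic_slice Ks (M + k) ?X"
  proof (rule conic_slice_preimage[OF s])
    fix i assume "i < N + k"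
    moreover have "linear_functional (M + k) (\<lambda>\<xi>. f i (vec M (\<lambda>j. \<xi> $ j)))" if "i < N"
      using assms(2)[OF that] by (rule linear_functional_compose) (simp add: linear_functional_index)
    ultimately show "linear_functional (M + k) (?f i)"
      by (cases "i < N") (simp_all add: linear_functional_index)
  qed
  have "x @\<^sub>v z \<in> ?X \<longleftrightarrow> vec N (\<lambda>i. f i x) @\<^sub>v z \<in> X'"
    if "x \<in> carrier_vec M" "z \<in> carrier_vec k" for x z
  proof -
    have "vec M (\<lambda>j. (x @\<^sub>v z) $ j) = x"
      using that by (intro eq_vecI) auto
    then have "vec (N + k) (\<lambda>i. ?f i (x @\<^sub>v z)) = vec N (\<lambda>i. f i x) @\<^sub>v z"
      using that by (intro eq_vecI) auto
    then show ?thesis using that by simp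
  qed
  then have "{x \<in> carrier_vec M. vec N (\<lambda>i. f i x) \<in> X} =
      {x \<in> carrier_vec M. \<exists>z \<in> carrier_vec k. (\<forall>j\<in>J. z $ j \<in> \<int>) \<and> x @\<^sub>v z \<in> ?X}"
    unfolding X by auto
  with slice J show ?thesis
    unfolding proj_conic_def by blast
qed

lemma proj_conic_cone_set:
  assumes "\<And>i. i < cone_dim K \<Longrightarrow> linear_functional M (f i)"
  shows "proj_conic mi M {x \<in> carrier_vec M. vec (cone_dim K) (\<lambda>i. f i x) \<in> cone_set K}"
  using conic_slice_cone_set[of K M f, OF assms] by (rule proj_conic_slice)

lemma proj_conic_nonneg:
  assumes "linear_functional M f"
  shows "proj_conic mi M {x \<in> carrier_vec M. 0 \<le> f x}"
  using proj_conic_cone_set[of "Orthant 1" M "\<lambda>i. f"] assms by simp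

lemma proj_conic_carrier: "proj_conic mi M (carrier_vec M)"
  using proj_conic_nonneg[OF linear_functional_zero] by simp

lemma proj_conic_conj:
  assumes "proj_conic mi M {x \<in> carrier_vec M. P x}" and "proj_conic mi M {x \<in> carrier_vec M. Q x}"
  shows "proj_conic mi M {x \<in> carrier_vec M. P x \<and> Q x}"
proof -
  have "{x \<in> carrier_vec M. P x \<and> Q x} =
      {x \<in> carrier_vec M. P x} \<inter> {x \<in> carrier_vec M. Q x}" by blast
  then show ?thesis using proj_conic_Int[OF assms] by simp
qed

lemma proj_conic_all:
  assumes "\<And>i. i < k \<Longrightarrow> proj_conic mi M {x \<in> carrier_vec M. P i x}"
  shows "proj_conic mi M {x \<in> carrier_vec M. \<forall>i<(k::nat). P i x}"
  using assms
proof (induction k)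
  case 0
  then show ?case by (simp add: proj_conic_carrier)
next
  case (Suc k)
  then have "proj_conic mi M {x \<in> carrier_vec M. (\<forall>i<k. P i x) \<and> P k x}"
    by (intro proj_conic_conj) auto
  then show ?case by (simp add: All_less_Suc conj_commute)
qed

lemma proj_conic_eq_zero:
  assumes "linear_functional M f"
  shows "proj_conic mi M {x \<in> carrier_vec M. f x = 0}"
proof -
  \<comment> \<open>The form \<open>0 - f x\<close> instead of a negation lets the rules for
    differences and for zero apply.\<close>
  have "proj_conic mi M {x \<in> carrier_vec M. 0 \<le> f x \<and> 0 \<le> 0 - f x}"
    by (intro proj_conic_conj proj_conic_nonneg linear_functional_intros assms)
  then show ?thesis
    by (rule arg_cong[THEN iffD1, rotated]) force
qed


section \<open>Representable sets as projected slices\<close>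

text \<open>Index \<open>N\<close> of the extended vector holds the integer copy, and two opposite
  inequalities in \<open>Orthant 2\<close> force it to equal \<open>x $ i\<close>. The flag is
  \<open>True\<close> because the copy is an integer auxiliary variable.\<close>

lemma proj_conic_index_Ints:
  assumes "i < N"
  shows "proj_conic True N {x \<in> carrier_vec N. x $ i \<in> \<int>}"
proof -
  let ?D = "{\<xi> \<in> carrier_vec (N + 1). vec 2 (\<lambda>j. if j = 0 then \<xi> $ i - \<xi> $ N else \<xi> $ N - \<xi> $ i)
    \<in> cone_set (Orthant 2)}"
  have "linear_functional (N + 1) (\<lambda>\<xi>. if (j :: nat) = 0 then \<xi> $ i - \<xi> $ N else \<xi> $ N - \<xi> $ i)" for j
    using assms by (cases "j = 0") (simp_all add: linear_functional_diff linear_functional_index)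
  then have slice: "conic_slice [Orthant 2] (N + 1) ?D"
    by (rule conic_slice_cone_set[of "Orthant 2", unfolded cone_dim.simps])
  have D: "x @\<^sub>v z \<in> ?D \<longleftrightarrow> x $ i = z $ 0" if "x \<in> carrier_vec N" "z \<in> carrier_vec 1" for x z
  proof -
    have "(x @\<^sub>v z) $ i = x $ i" "(x @\<^sub>v z) $ N = z $ 0" "x @\<^sub>v z \<in> carrier_vec (N + 1)"
      using that assms by (auto intro: carrier_vecI)
    moreover have "(\<forall>j<2. 0 \<le> (if j = (0 :: nat) then r - t else t - r)) \<longleftrightarrow> r = t" for r t :: real
      by (auto simp: numeral_2_eq_2 All_less_Suc)
    ultimately show ?thesis by simp
  qed
  have "{x \<in> carrier_vec N. x $ i \<in> \<int>} = {x \<in> carrier_vec N. \<exists>z \<in> carrier_vec 1.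
      (\<forall>j\<in>{0}. z $ j \<in> \<int>) \<and> x @\<^sub>v z \<in> ?D}"
  proof (intro Collect_cong conj_cong refl iffI)
    fix x :: "real vec" assume x: "x \<in> carrier_vec N"
    { assume "x $ i \<in> \<int>"
      moreover have "vec 1 (\<lambda>_. x $ i) \<in> carrier_vec 1" by simp
      ultimately show "\<exists>z \<in> carrier_vec 1. (\<forall>j\<in>{0}. z $ j \<in> \<int>) \<and> x @\<^sub>v z \<in> ?D"
        by (intro bexI[of _ "vec 1 (\<lambda>_. x $ i)"]) (simp_all only: D[OF x], simp) }
    { assume "\<exists>z \<in> carrier_vec 1. (\<forall>j\<in>{0}. z $ j \<in> \<int>) \<and> x @\<^sub>v z \<in> ?D"
      then obtain z where z: "z \<in> carrier_vec 1" and "z $ 0 \<in> \<int>" "x @\<^sub>v z \<in> ?D"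
        by (elim bexE conjE) (simp only: ball_simps)
      then show "x $ i \<in> \<int>"
        by (simp only: D[OF x z]) }
  qed
  then show ?thesis
    using slice unfolding proj_conic_def
    by (intro exI[of _ 1] exI[of _ "[Orthant 2]"] exI[of _ ?D] exI[of _ "{0}"]) auto
qed

text \<open>The rows \<open>?g\<close> are those of the block matrix (A | B) acting on the
  concatenation of \<open>x\<close> and \<open>z\<close>. The slice is described only through its
  concatenated members, the form in which \<open>proj_conic\<close> tests it.\<close>

lemma conic_slice_matrices:
  assumes A: "A \<in> carrier_mat (prod_dim Ks) n" and B: "B \<in> carrier_mat (prod_dim Ks) k"
    and b: "b \<in> carrier_vec (prod_dim Ks)"
  shows "\<exists>X. conic_slice Ks (n + k) X \<and>
    (\<forall>x \<in> carrier_vec n. \<forall>z \<in> carrier_vec k.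
      x @\<^sub>v z \<in> X \<longleftrightarrow> cone_ge (prod_cone Ks) (A *\<^sub>v x + B *\<^sub>v z) b)"
proof (intro exI conjI ballI)
  let ?g = "\<lambda>i \<xi>. (A *\<^sub>v vec n (\<lambda>j. \<xi> $ j)) $ i + (B *\<^sub>v vec k (\<lambda>j. \<xi> $ (n + j))) $ i"
  let ?X = "{\<xi> \<in> carrier_vec (n + k). vec (prod_dim Ks) (\<lambda>i. ?g i \<xi> - b $ i) \<in> prod_cone Ks}"
  show "conic_slice Ks (n + k) ?X"
  proof (rule conic_sliceI)
    fix i assume i: "i < prod_dim Ks"
    show "linear_functional (n + k) (?g i)"
      by (intro linear_functional_add
          linear_functional_compose[OF linear_functional_mult_mat_vec[OF A i]]
          linear_functional_compose[OF linear_functional_mult_mat_vec[OF B i]]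
          linear_functional_index) auto
  qed simp
  fix x z :: "real vec" assume x: "x \<in> carrier_vec n" and z: "z \<in> carrier_vec k"
  have "vec n (\<lambda>j. (x @\<^sub>v z) $ j) = x" "vec k (\<lambda>j. (x @\<^sub>v z) $ (n + j)) = z"
    using x z by (auto intro!: eq_vecI)
  moreover have "vec (prod_dim Ks) (\<lambda>i. (A *\<^sub>v x) $ i + (B *\<^sub>v z) $ i - b $ i) =
      A *\<^sub>v x + B *\<^sub>v z - b"
    using A B b by (intro eq_vecI) auto
  moreover have "x @\<^sub>v z \<in> carrier_vec (n + k)"
    using x z by (rule append_carrier_vec)
  ultimately show "x @\<^sub>v z \<in> ?X \<longleftrightarrow> cone_ge (prod_cone Ks) (A *\<^sub>v x + B *\<^sub>v z) b"
    unfolding cone_ge_def by simp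
qed

text \<open>Integrality of \<open>z\<close> already has the shape required by
  \<open>proj_conic\<close>; integrality of the original coordinates in \<open>I\<close> does not,
  and is intersected in one coordinate at a time.\<close>

lemma proj_conic_of_mi_conic_representable:
  assumes "mi_conic_representable n X"
  shows "proj_conic True n X"
proof -
  obtain k Ks A B b I J where A: "A \<in> carrier_mat (prod_dim Ks) n"
    and B: "B \<in> carrier_mat (prod_dim Ks) k" and b: "b \<in> carrier_vec (prod_dim Ks)"
    and I: "I \<subseteq> {..<n}" and J: "J \<subseteq> {..<k}"
    and X: "X = {x \<in> carrier_vec n. (\<forall>i\<in>I. x $ i \<in> \<int>) \<and>
               (\<exists>z \<in> carrier_vec k. (\<forall>j\<in>J. z $ j \<in> \<int>) \<and>
                  cone_ge (prod_cone Ks) (A *\<^sub>v x + B *\<^sub>v z) b)}"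
    using assms unfolding mi_conic_representable_def by blast
  obtain W where W: "conic_slice Ks (n + k) W"
    and memW: "\<forall>x \<in> carrier_vec n. \<forall>z \<in> carrier_vec k.
      x @\<^sub>v z \<in> W \<longleftrightarrow> cone_ge (prod_cone Ks) (A *\<^sub>v x + B *\<^sub>v z) b"
    using conic_slice_matrices[OF A B b] by blast
  have "proj_conic True n {x \<in> carrier_vec n.
      \<exists>z \<in> carrier_vec k. (\<forall>j\<in>J. z $ j \<in> \<int>) \<and> x @\<^sub>v z \<in> W}"
    unfolding proj_conic_def using W J by blast
  \<comment> \<open>Ranging over all \<open>i < n\<close> suits \<open>proj_conic_all\<close>; for
    an index outside \<open>I\<close> the conjunct describes the whole space.\<close>
  moreover have "proj_conic True n {x \<in> carrier_vec n. \<forall>i<n. i \<in> I \<longrightarrow> x $ i \<in> \<int>}"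
  proof (rule proj_conic_all)
    fix i assume "i < n"
    then show "proj_conic True n {x \<in> carrier_vec n. i \<in> I \<longrightarrow> x $ i \<in> \<int>}"
      by (cases "i \<in> I") (simp_all add: proj_conic_index_Ints proj_conic_carrier)
  qed
  ultimately have "proj_conic True n {x \<in> carrier_vec n.
      (\<exists>z \<in> carrier_vec k. (\<forall>j\<in>J. z $ j \<in> \<int>) \<and> x @\<^sub>v z \<in> W) \<and>
      (\<forall>i<n. i \<in> I \<longrightarrow> x $ i \<in> \<int>)}"
    by (rule proj_conic_conj)
  moreover have "(\<forall>i<n. i \<in> I \<longrightarrow> x $ i \<in> \<int>) \<longleftrightarrow> (\<forall>i\<in>I. x $ i \<in> \<int>)" for x :: "real vec"
    using I by blast
  ultimately show ?thesis
    unfolding X by (simp add: memW conj_commute cong: conj_cong bex_cong)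
qed

text \<open>Since \<open>J\<close> is empty the flag is free, so \<open>h\<close> and the
  \<open>H i\<close> can be used in the continuous and in the mixed-integer case alike.\<close>

lemma proj_conic_of_conic_representable:
  assumes "conic_representable n X"
  shows "proj_conic mi n X"
proof -
  obtain k Ks A B b where A: "A \<in> carrier_mat (prod_dim Ks) n"
    and B: "B \<in> carrier_mat (prod_dim Ks) k" and b: "b \<in> carrier_vec (prod_dim Ks)"
    and X: "X = {x \<in> carrier_vec n. \<exists>z \<in> carrier_vec k.
               cone_ge (prod_cone Ks) (A *\<^sub>v x + B *\<^sub>v z) b}"
    using assms unfolding conic_representable_def by blast
  obtain W where W: "conic_slice Ks (n + k) W"
    and memW: "\<forall>x \<in> carrier_vec n. \<forall>z \<in> carrier_vec k.
      x @\<^sub>v z \<in> W \<longleftrightarrow> cone_ge (prod_cone Ks) (A *\<^sub>v x + B *\<^sub>v z) b"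
    using conic_slice_matrices[OF A B b] by blast
  have "X = {x \<in> carrier_vec n. \<exists>z \<in> carrier_vec k. (\<forall>j\<in>{}. z $ j \<in> \<int>) \<and> x @\<^sub>v z \<in> W}"
    unfolding X using memW by auto
  then show ?thesis
    unfolding proj_conic_def using W by blast
qed

section \<open>The kinds of constraints occurring in (R)\<close>

text \<open>The epigraph is pulled back along the linear map sending \<open>x\<close> to
  \<open>vec_first x n\<close> followed by \<open>g x\<close>. Allowing any linear \<open>g\<close>
  covers both bounds needed later: \<alpha> - v for the \<open>H i\<close>, and the epigraph
  variable for \<open>h\<close>.\<close>

lemma proj_conic_epigraph:
  assumes "conic_representable_fun n f" and "n \<le> M" and "linear_functional M g"
  shows "proj_conic mi M {x \<in> carrier_vec M. f (vec_first x n) \<le> g x}"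
proof -
  have mem: "vec (n + 1) (\<lambda>i. if i < n then x $ i else g x) \<in> epigraph_vec n f \<longleftrightarrow>
      f (vec_first x n) \<le> g x" for x
  proof -
    have split: "vec (n + 1) (\<lambda>i. if i < n then x $ i else g x) = vec_first x n @\<^sub>v vec_of_list [g x]"
      by (intro eq_vecI) (auto simp: vec_first_def less_Suc_eq)
    have eq: "vec_first x n @\<^sub>v vec_of_list [g x] = y @\<^sub>v vec_of_list [t] \<longleftrightarrow> vec_first x n = y \<and> g x = t"
      if "y \<in> carrier_vec n" for y t
      using append_vec_eq[OF vec_first_carrier that, of x "vec_of_list [g x]" "vec_of_list [t]"]
      \<comment> \<open>\<open>list_vec\<close> recovers the one-element list, hence the number,
        from the vector.\<close>
      by (metis list_vec list.inject)
    show ?thesis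
    proof
      assume "vec (n + 1) (\<lambda>i. if i < n then x $ i else g x) \<in> epigraph_vec n f"
      then obtain y t where "vec_first x n @\<^sub>v vec_of_list [g x] = y @\<^sub>v vec_of_list [t]"
        "y \<in> carrier_vec n" "f y \<le> t"
        unfolding split epigraph_vec_def mem_Collect_eq by (elim exE conjE)
      with eq show "f (vec_first x n) \<le> g x"
        by metis
    next
      assume "f (vec_first x n) \<le> g x"
      then show "vec (n + 1) (\<lambda>i. if i < n then x $ i else g x) \<in> epigraph_vec n f"
        unfolding split epigraph_vec_def using vec_first_carrier by blast
    qed
  qed
  have "linear_functional M (\<lambda>x. if i < n then x $ i else g x)" for i
    using assms(2,3) by (cases "i < n") (simp_all add: linear_functional_index)
  then have "proj_conic mi M {x \<in> carrier_vec M.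
      vec (n + 1) (\<lambda>i. if i < n then x $ i else g x) \<in> epigraph_vec n f}"
    using assms(1) unfolding conic_representable_fun_def
    by (intro proj_conic_preimage proj_conic_of_conic_representable)
  then show ?thesis unfolding mem .
qed

lemma proj_conic_vec_first:
  assumes "proj_conic mi n X" and "n \<le> M"
  shows "proj_conic mi M {x \<in> carrier_vec M. vec_first x n \<in> X}"
  unfolding vec_first_def using assms
  by (intro proj_conic_preimage linear_functional_index) auto

lemma proj_conic_dual_exp_cone:
  assumes "linear_functional M f" "linear_functional M g" "linear_functional M h"
  shows "proj_conic mi M {x \<in> carrier_vec M. (f x, g x, h x) \<in> dual_exp_cone}"
proof -
  let ?F = "\<lambda>i x. [f x, g x, h x] ! i"
  have "vec (cone_dim DualExp) (\<lambda>i. ?F i x) = vec_of_list [f x, g x, h x]" for x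
    by (intro eq_vecI) (auto simp: vec_of_list_index simp del: vec_of_list_Cons)
  moreover have "vec_of_list [a, b, c] \<in> cone_set DualExp \<longleftrightarrow> (a, b, c) \<in> dual_exp_cone" for a b c
    unfolding cone_set.simps mem_Collect_eq by (metis list_vec list.inject)
  moreover have "proj_conic mi M {x \<in> carrier_vec M.
      vec (cone_dim DualExp) (\<lambda>i. ?F i x) \<in> cone_set DualExp}"
  proof (rule proj_conic_cone_set)
    fix i assume "i < cone_dim DualExp"
    then consider "i = 0" | "i = 1" | "i = 2" by fastforce
    then show "linear_functional M (?F i)" using assms by cases simp_all
  qed
  ultimately show ?thesis by simp
qed

section \<open>From a projected slice to a conic program\<close>

text \<open>The zero map into the dual exponential cone: a vacuous constraint that can be added to any
  program, so the list of its cones always contains \<^const>\<open>DualExp\<close>.\<close>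

lemma dual_exp_slice_whole:
  "conic_slice [DualExp] M (carrier_vec M)"
proof -
  have "(0, 0, 0) \<in> dual_exp_cone" by (simp add: dual_exp_cone_def inner_prod_def)
  moreover have "vec (cone_dim DualExp) (\<lambda>i. 0) = vec_of_list [0, 0, 0 :: real]"
    by (intro eq_vecI) (auto simp: vec_of_list_index nth_Cons' simp del: vec_of_list_Cons)
  ultimately have "vec (cone_dim DualExp) (\<lambda>i. 0) \<in> cone_set DualExp"
    unfolding cone_set.simps by blast
  then show ?thesis
    using conic_slice_cone_set[of DualExp M "\<lambda>i x. 0"] by (simp add: linear_functional_zero)
qed

text \<open>The epigraph variable t has index \<open>N\<close>, right after the original variables
  and before the auxiliary ones. Feasibility gives t + g \<ge> f + g, and the choice t = f x gives
  equality: these are the two halves of \<open>written_as\<close>.\<close>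

lemma proj_conic_program:
  assumes "proj_conic mi (N + 1) {x \<in> carrier_vec (N + 1). vec_first x N \<in> F \<and> f (vec_first x N) \<le> x $ N}"
    and "F \<subseteq> carrier_vec N" and "linear_functional N g"
  obtains P where "wf_program P" "DualExp \<in> set (cones P)" "int_vars P \<noteq> {} \<longrightarrow> mi"
    "written_as N F (\<lambda>x. f x + g x) P"
proof -
  let ?G = "{x \<in> carrier_vec (N + 1). vec_first x N \<in> F \<and> f (vec_first x N) \<le> x $ N}"
  obtain k Ks X' J where s: "conic_slice Ks (N + 1 + k) X'" and J: "J \<subseteq> {..<k}" "J \<noteq> {} \<longrightarrow> mi"
    and G: "?G = {x \<in> carrier_vec (N + 1). \<exists>z \<in> carrier_vec k. (\<forall>j\<in>J. z $ j \<in> \<int>) \<and> x @\<^sub>v z \<in> X'}"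
    using assms(1) unfolding proj_conic_def by blast
  let ?M = "N + 1 + k" and ?Ks = "DualExp # Ks"
  have "conic_slice ?Ks ?M X'"
    using conic_slice_Int[OF dual_exp_slice_whole s] conic_slice_subset[OF s] by (simp add: Int_absorb1)
  then obtain A b where A: "A \<in> carrier_mat (prod_dim ?Ks) ?M" and b: "b \<in> carrier_vec (prod_dim ?Ks)"
    and X': "X' = {x \<in> carrier_vec ?M. cone_ge (prod_cone ?Ks) (A *\<^sub>v x) b}"
    unfolding conic_slice_def by blast
  have "linear_functional ?M (\<lambda>\<xi>. \<xi> $ N + g (vec N (\<lambda>i. \<xi> $ i)))"
    by (intro linear_functional_add linear_functional_index linear_functional_compose[OF assms(3)]) auto
  then obtain c where c: "\<And>\<xi>. \<xi> \<in> carrier_vec ?M \<Longrightarrow>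
      \<xi> $ N + g (vec_first \<xi> N) = (\<Sum>i<?M. c i * \<xi> $ i)"
    unfolding linear_functional_def vec_first_def by blast
  \<comment> \<open>Linear constraints already sit among the cone rows, so both linear blocks have
    no rows. The integer indices are shifted past the original variables and t.\<close>
  define P where "P = \<lparr>num_vars = ?M, cost = vec ?M c, eq_mat = 0\<^sub>m 0 ?M, eq_rhs = 0\<^sub>v 0,
    ineq_mat = 0\<^sub>m 0 ?M, ineq_rhs = 0\<^sub>v 0, cones = ?Ks, cone_mat = A, cone_rhs = b,
    int_vars = (+) (N + 1) ` J\<rparr>"
  have obj: "program_objective P \<xi> = \<xi> $ N + g (vec_first \<xi> N)" if "\<xi> \<in> carrier_vec ?M" for \<xi>
    using that c[OF that] unfolding program_objective_def P_def
    by (simp add: scalar_prod_def atLeast0LessThan)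
  have feas: "program_feasible P = {\<xi> \<in> X'. \<forall>j\<in>J. \<xi> $ (N + 1 + j) \<in> \<int>}"
    unfolding program_feasible_def P_def X' by auto
  have first: "vec_first (x @\<^sub>v z) N = vec_first x N" "(x @\<^sub>v z) $ N = x $ N"
    if "x \<in> carrier_vec (N + 1)" for x z :: "real vec"
    using that by (auto simp: vec_first_def intro!: eq_vecI)
  have append_feas: "x @\<^sub>v z \<in> program_feasible P \<longleftrightarrow> x @\<^sub>v z \<in> X' \<and> (\<forall>j\<in>J. z $ j \<in> \<int>)"
    if "x \<in> carrier_vec (N + 1)" "z \<in> carrier_vec k" for x z
  proof -
    have "(x @\<^sub>v z) $ (N + 1 + j) = z $ j" if "j \<in> J" for j
      using \<open>x \<in> _\<close> \<open>z \<in> _\<close> that J by (subst index_append_vec) auto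
    then show ?thesis unfolding feas by simp
  qed
  have "wf_program P"
    unfolding wf_program_def P_def using A b J by auto
  moreover have "written_as N F (\<lambda>x. f x + g x) P"
    unfolding written_as_def
  proof (intro conjI ballI)
    show "N \<le> num_vars P" by (simp add: P_def)
  next
    fix \<xi> assume \<xi>: "\<xi> \<in> program_feasible P"
    then have carr: "\<xi> \<in> carrier_vec ?M" unfolding feas X' by blast
    define x z where "x = vec_first \<xi> (N + 1)" and "z = vec_last \<xi> k"
    have x: "x \<in> carrier_vec (N + 1)" and z: "z \<in> carrier_vec k" and e: "\<xi> = x @\<^sub>v z"
      unfolding x_def z_def using vec_first_last_append[OF carr] by simp_all
    have "x \<in> ?G"
      unfolding G using \<xi> x z append_feas[OF x z] unfolding e by blast
    then have "vec_first \<xi> N \<in> F" "f (vec_first \<xi> N) \<le> \<xi> $ N"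
      unfolding e first[OF x] by simp_all
    then show "vec_first \<xi> N \<in> F" "f (vec_first \<xi> N) + g (vec_first \<xi> N) \<le> program_objective P \<xi>"
      unfolding obj[OF carr] by simp_all
  next
    fix x assume x: "x \<in> F"
    then have carr: "x \<in> carrier_vec N" using assms(2) by blast
    \<comment> \<open>The epigraph variable takes its least admissible value, which makes the
      objective exact.\<close>
    define y where "y = x @\<^sub>v vec 1 (\<lambda>_. f x)"
    have y: "y \<in> carrier_vec (N + 1)" "y $ N = f x" and yx: "vec_first y N = x"
      using carr unfolding y_def by (auto simp: vec_first_def intro!: eq_vecI carrier_vecI)
    then have "y \<in> ?G" using x by simp
    then obtain z where z: "z \<in> carrier_vec k" and "\<forall>j\<in>J. z $ j \<in> \<int>" "y @\<^sub>v z \<in> X'"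
      unfolding G by blast
    then have "y @\<^sub>v z \<in> program_feasible P"
      using append_feas[OF y(1) z] by blast
    moreover have "program_objective P (y @\<^sub>v z) = f x + g x"
      using obj[OF append_carrier_vec[OF y(1) z]] by (simp only: first[OF y(1)] y(2) yx)
    ultimately show "\<exists>\<xi> \<in> program_feasible P. vec_first \<xi> N = x \<and> program_objective P \<xi> = f x + g x"
      using first(1)[OF y(1)] yx by metis
  qed
  ultimately show thesis
    using that[of P] J(2) by (simp add: P_def)
qed

section \<open>Assembling the robust counterpart\<close>

text \<open>Each of the families \<open>u\<close>, \<open>v\<close>, \<open>w\<close> occupies
  \<open>offset S m\<close> consecutive entries; this bound keeps its members inside that range and
  yields all their index bounds.\<close>

lemma offset_less:
  assumes "i < m" and "s < S i"
  shows "offset S i + s < offset S m"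
proof -
  have "offset S i + S i = offset S (Suc i)" by (simp add: offset_def)
  also have "\<dots> \<le> offset S m"
    unfolding offset_def using assms(1) by (intro sum_mono2) auto
  finally show ?thesis using assms(2) by simp
qed

lemma proj_conic_rc_feasible:
  assumes "proj_conic mi n Y"
    and H: "\<And>i \<xi>. i < m \<Longrightarrow> conic_representable_fun n (\<lambda>y. H i y \<xi>)"
  shows "proj_conic mi (rc_dim n m S) (rc_feasible n m Y H S d)"
proof -
  let ?N = "rc_dim n m S"
  have idx: "n + i < ?N" "n + m + i < ?N" if "i < m" for i
    using that unfolding rc_dim_def by linarith+
  have idx2: "n + 2 * m + offset S i + s < ?N" "n + 2 * m + offset S m + offset S i + s < ?N"
    "n + 2 * m + 2 * offset S m + offset S i + s < ?N" if "i < m" "s < S i" for i s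
    using offset_less[of i m s S, OF that] unfolding rc_dim_def by linarith+
  \<comment> \<open>\<open>y_of\<close> is written as \<open>vec_first\<close> so that the closure
    rules match the conjuncts syntactically; what remains is that every index lies below
    \<open>?N\<close>.\<close>
  have "proj_conic mi ?N {x \<in> carrier_vec ?N.
        (\<forall>i<m. \<forall>s<S i. H i (vec_first x n) (d i s) \<le> alpha_of n x i - v_of n m S x i s) \<and>
        (\<forall>i<m. \<forall>s<S i. beta_of n m x i + w_of n m S x i s = 0) \<and>
        (\<forall>i<m. 0 \<le> beta_of n m x i) \<and>
        (\<forall>i<m. \<forall>s<S i.
           (u_of n m S x i s, v_of n m S x i s, w_of n m S x i s) \<in> dual_exp_cone) \<and>
        vec_first x n \<in> Y}"
    unfolding alpha_of_def beta_of_def u_of_def v_of_def w_of_def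
    by (intro proj_conic_conj proj_conic_all proj_conic_epigraph[OF H] proj_conic_eq_zero
        proj_conic_nonneg proj_conic_dual_exp_cone proj_conic_vec_first assms(1)
        linear_functional_add linear_functional_diff linear_functional_index idx idx2)
      (simp_all add: rc_dim_def)
  then show ?thesis
    unfolding rc_feasible_def y_of_def by simp
qed

lemma rc_program:
  assumes Y: "proj_conic mi n Y"
    and h: "conic_representable_fun n h"
    and H: "\<And>i \<xi>. i < m \<Longrightarrow> conic_representable_fun n (\<lambda>y. H i y \<xi>)"
  obtains P where "wf_program P" "DualExp \<in> set (cones P)" "int_vars P \<noteq> {} \<longrightarrow> mi"
    "written_as (rc_dim n m S) (rc_feasible n m Y H S d) (rc_objective n m h S q \<epsilon>) P"
proof -
  let ?N = "rc_dim n m S" and ?F = "rc_feasible n m Y H S d"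
  let ?g = "\<lambda>x. \<Sum>i<m. alpha_of n x i + \<epsilon> i * beta_of n m x i +
        (\<Sum>s<S i. q i $ s * u_of n m S x i s)"
  have F: "proj_conic mi ?N ?F" using Y H by (rule proj_conic_rc_feasible)
  have n: "n \<le> ?N" by (simp add: rc_dim_def)
  \<comment> \<open>Appending the epigraph variable does not move \<open>y\<close>, so the bound on
    \<open>h\<close> can be read off the extended vector.\<close>
  have "y_of n (vec_first x ?N) = vec_first x n" for x
    using n by (auto simp: y_of_def vec_first_def intro!: eq_vecI)
  moreover have "proj_conic mi (?N + 1) {x \<in> carrier_vec (?N + 1).
      vec_first x ?N \<in> ?F \<and> h (vec_first x n) \<le> x $ ?N}"
    using n by (intro proj_conic_conj proj_conic_vec_first F proj_conic_epigraph h
        linear_functional_index) auto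
  ultimately have "proj_conic mi (?N + 1) {x \<in> carrier_vec (?N + 1).
      vec_first x ?N \<in> ?F \<and> h (y_of n (vec_first x ?N)) \<le> x $ ?N}" by simp
  moreover have "linear_functional ?N ?g"
  proof -
    have "n + i < ?N" "n + m + i < ?N" if "i < m" for i
      using that unfolding rc_dim_def by linarith+
    moreover have "n + 2 * m + offset S i + s < ?N" if "i < m" "s < S i" for i s
      using offset_less[of i m s S, OF that] unfolding rc_dim_def by linarith
    ultimately show ?thesis
      unfolding alpha_of_def beta_of_def u_of_def
      by (intro linear_functional_sum linear_functional_add linear_functional_scale
          linear_functional_index)
  qed
  ultimately obtain P where "wf_program P" "DualExp \<in> set (cones P)" "int_vars P \<noteq> {} \<longrightarrow> mi"
    "written_as ?N ?F (\<lambda>x. h (y_of n x) + ?g x) P"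
    using proj_conic_program[OF _ proj_conic_subset[OF F], of mi "\<lambda>x. h (y_of n x)" ?g] by blast
  then show thesis
    using that unfolding rc_objective_def by blast
qed

theorem corollary2:
  fixes m n :: nat
    and Y :: "real vec set"
    and h :: "real vec \<Rightarrow> real"
    and H :: "nat \<Rightarrow> real vec \<Rightarrow> real \<Rightarrow> real"
    and S :: "nat \<Rightarrow> nat"
    and d :: "nat \<Rightarrow> nat \<Rightarrow> real"
    and q :: "nat \<Rightarrow> real vec"
    and \<epsilon> :: "nat \<Rightarrow> real"
  assumes "m \<ge> 1" and "n \<ge> 1"
    and "Y \<subseteq> carrier_vec n"
    and "\<And>i. i < m \<Longrightarrow> S i \<ge> 1"
    and "\<And>i. i < m \<Longrightarrow> q i \<in> rel_interior_vec (simplex (S i))"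
    and "\<And>i. i < m \<Longrightarrow> \<epsilon> i > 0"
    and "conic_representable_fun n h"
    and "\<And>i \<xi>. i < m \<Longrightarrow> conic_representable_fun n (\<lambda>y. H i y \<xi>)"
  shows "(conic_representable n Y \<longrightarrow>
            dual_exp_program (rc_dim n m S) (rc_feasible n m Y H S d)
              (rc_objective n m h S q \<epsilon>)) \<and>
         (mi_conic_representable n Y \<longrightarrow>
            dual_exp_mi_program (rc_dim n m S) (rc_feasible n m Y H S d)
              (rc_objective n m h S q \<epsilon>))"
proof (intro conjI impI)
  assume "conic_representable n Y"
  \<comment> \<open>With the flag \<open>False\<close>, \<open>rc_program\<close> yields a program
    whose set of integer variables is empty.\<close>
  then have "proj_conic False n Y" by (rule proj_conic_of_conic_representable)
  then obtain P where "wf_program P" "DualExp \<in> set (cones P)" "int_vars P \<noteq> {} \<longrightarrow> False"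
    "written_as (rc_dim n m S) (rc_feasible n m Y H S d) (rc_objective n m h S q \<epsilon>) P"
    using assms(7,8) by (rule rc_program)
  then show "dual_exp_program (rc_dim n m S) (rc_feasible n m Y H S d) (rc_objective n m h S q \<epsilon>)"
    unfolding dual_exp_program_def by (intro exI[of _ P]) simp
next
  assume "mi_conic_representable n Y"
  then have "proj_conic True n Y" by (rule proj_conic_of_mi_conic_representable)
  then obtain P where "wf_program P" "DualExp \<in> set (cones P)" "int_vars P \<noteq> {} \<longrightarrow> True"
    "written_as (rc_dim n m S) (rc_feasible n m Y H S d) (rc_objective n m h S q \<epsilon>) P"
    using assms(7,8) by (rule rc_program)
  then show "dual_exp_mi_program (rc_dim n m S) (rc_feasible n m Y H S d) (rc_objective n m h S q \<epsilon>)"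
    unfolding dual_exp_mi_program_def by (intro exI[of _ P]) simp
qed

end
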